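(* Let the aggregation function $t$ (with $m$ arguments) be monotone. Let $\mathbf{D}$ be the class of all databases (with $m$ sorted lists). Let $\mathbf{A}$ be the class of all algorithms that correctly find the top $k$ objects for $t$ for every database and that do not make random accesses. Then the algorithm NRA is instance optimal over $\mathbf{A}$ and $\mathbf{D}$.
   Context: Setting: fix positive integers $m$ and $k$ (treated as constants). A database consists of a finite set of $N\ge k$ objects; each object $R$ has $m$ grades (fields) $x_1,\dots,x_m\in[0,1]$. It is presented as $m$ sorted lists $L_1,\dots,L_m$ of length $N$; list $L_i$ contains one entry $(R,x_i)$ for each object $R$, in descending order of $x_i$ (the order among ties is part of the database). An aggregation function is a fixed function $t:[0,1]^m\to[0,\infty)$; the overall grade of $R$ is $t(R)=t(x_1,\dots,x_m)$. $t$ is monotone if $t(x_1,\dots,x_m)\le t(x_1',\dots,x_m')$ whenever $x_i\le x_i'$ for every $i$. Finding the top $k$ objects means outputting $k$ objects with the highest overall grades (ties broken arbitrarily); their grades and their relative order need not be output. Access and cost: an algorithm that makes no random accesses obtains information about the database only by sorted access (reading the next entry of some list, proceeding sequentially from the top). With $s$ sorted accesses its middleware cost is $s c_S$, where $c_S>0$ is a fixed constant; $cost(\mathcal A,\mathcal D)$ is the cost of algorithm $\mathcal A$ on database $\mathcal D$. Instance optimality: algorithm $\mathcal B$ is instance optimal over $\mathbf A$ and $\mathbf D$ if $\mathcal B\in\mathbf A$ and there are constants $c,c'$ such that $cost(\mathcal B,\mathcal D)\le c\cdot cost(\mathcal A,\mathcal D)+c'$ for every $\mathcal A\in\mathbf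 A$ and $\mathcal D\in\mathbf D$. Bounds: for an object $R$ with set $S\subseteq\{1,\dots,m\}$ of known fields, $W_S(R)$ is the value of $t$ obtained by using the known values for the fields in $S$ and $0$ for every other field; $B_S(R)$ is the value of $t$ obtained by using the known values for the fields in $S$ and $\underline{x}_i$ for every field $i\notin S$, where $\underline{x}_i$ (the bottom value) is the last value obtained under sorted access in $L_i$. Algorithm NRA: (1) Do sorted access in parallel to each of the lists. At each depth $d$ (when $d$ entries have been read in each list): maintain the bottom values $\underline{x}_i^{(d)}$; for every object $R$ with discovered fields $S=S^{(d)}(R)$ let $W^{(d)}(R)=W_S(R)$ and $B^{(d)}(R)=B_S(R)$ (for unseen $R$, $S=\emptyset$, so $W^{(d)}(R)=t(0,\dots,0)$ and $B^{(d)}(R)=t(\underline{x}_1^{(d)},\dots,\underline{x}_m^{(d)})$). Let $T_k^{(d)}$ contain the $k$ objects seen so far with the largest $W^{(d)}$ values, ties being broken in favor of the larger $B^{(d)}$ value (and arbitrarily if these also tie). Let $M_k^{(d)}$ be the $k$th largest $W^{(d)}$ value in $T_k^{(d)}$. (2) Halt when (a) at least $k$ distinct objects have been seen and (b) $B^{(d)}(R)\le M_k^{(d)}$ for all objects $R\notin T_k^{(d)}$. Return the objects in $T_k^{(d)}$. *)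

theory Defs
  imports Complex_Main
begin

section \<open>Databases and aggregation functions\<close>

text \<open>Lists and fields are numbered \<open>0, \<dots>, m - 1\<close>; a point of $[0,1]^m$ is a list of length \<open>m\<close>.
  The order among tied entries of a sorted list is part of the database.\<close>

record 'o database =
  objs :: "'o set"
  grade :: "'o \<Rightarrow> nat \<Rightarrow> real"
  slists :: "('o \<times> real) list list"

definition databases :: "nat \<Rightarrow> nat \<Rightarrow> 'o database set" where
  "databases m k = {D. finite (objs D) \<and> k \<le> card (objs D) \<and>
     (\<forall>R\<in>objs D. \<forall>i<m. grade D R i \<in> {0..1}) \<and>
     length (slists D) = m \<and>
     (\<forall>i<m. distinct (slists D ! i) \<and>
            set (slists D ! i) = (\<lambda>R. (R, grade D R i)) ` objs D \<and>
            sorted_wrt (\<lambda>p q. snd p \<ge> snd q) (slists D ! i))}"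

definition unit_cube :: "nat \<Rightarrow> real list set" where
  "unit_cube m = {xs. length xs = m \<and> set xs \<subseteq> {0..1}}"

definition aggregation :: "nat \<Rightarrow> (real list \<Rightarrow> real) \<Rightarrow> bool" where
  "aggregation m t \<longleftrightarrow> (\<forall>xs\<in>unit_cube m. 0 \<le> t xs)"

definition monotone_aggregation :: "nat \<Rightarrow> (real list \<Rightarrow> real) \<Rightarrow> bool" where
  "monotone_aggregation m t \<longleftrightarrow>
     (\<forall>xs\<in>unit_cube m. \<forall>ys\<in>unit_cube m. (\<forall>i<m. xs ! i \<le> ys ! i) \<longrightarrow> t xs \<le> t ys)"

definition overall :: "nat \<Rightarrow> (real list \<Rightarrow> real) \<Rightarrow> 'o database \<Rightarrow> 'o \<Rightarrow> real" where
  "overall m t D R = t (map (grade D R) [0..<m])"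

definition top_k :: "nat \<Rightarrow> nat \<Rightarrow> (real list \<Rightarrow> real) \<Rightarrow> 'o database \<Rightarrow> 'o set \<Rightarrow> bool" where
  "top_k m k t D Y \<longleftrightarrow> Y \<subseteq> objs D \<and> card Y = k \<and>
     (\<forall>R\<in>Y. \<forall>R'\<in>objs D - Y. overall m t D R' \<le> overall m t D R)"


section \<open>Algorithms without random access\<close>

text \<open>An algorithm is an arbitrary deterministic strategy: from the sorted accesses made so far and
  their results it determines the next sorted access, or halts with an output. It also knows which
  objects the database contains (the halting rule of NRA refers to all of them), but learns anything
  about their grades and ranks only through sorted access.
  The result \<open>None\<close> records an access to an exhausted (or non-existent) list; it costs as much as
  any other access.\<close>

type_synonym 'o history = "(nat \<times> ('o \<times> real) option) list"

datatype 'o action = Access nat | Output "'o set"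

type_synonym 'o algorithm = "'o set \<Rightarrow> 'o history \<Rightarrow> 'o action"

definition entries_read :: "'o history \<Rightarrow> nat \<Rightarrow> ('o \<times> real) list" where
  "entries_read h i = [the r. (j, r) \<leftarrow> h, j = i \<and> r \<noteq> None]"

definition next_entry :: "'o database \<Rightarrow> 'o history \<Rightarrow> nat \<Rightarrow> ('o \<times> real) option" where
  "next_entry D h i =
     (if i < length (slists D) \<and> length (entries_read h i) < length (slists D ! i)
      then Some (slists D ! i ! length (entries_read h i)) else None)"

fun history_after :: "'o algorithm \<Rightarrow> 'o database \<Rightarrow> nat \<Rightarrow> 'o history" where
  "history_after A D 0 = []"
| "history_after A D (Suc n) =
     (let h = history_after A D n in
      case A (objs D) h of Access i \<Rightarrow> h @ [(i, next_entry D h i)] | Output Y \<Rightarrow> h)"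

definition outputs_after :: "'o algorithm \<Rightarrow> 'o database \<Rightarrow> nat \<Rightarrow> 'o set \<Rightarrow> bool" where
  "outputs_after A D s Y \<longleftrightarrow> A (objs D) (history_after A D s) = Output Y"

text \<open>Meaningful only if \<open>A\<close> halts on \<open>D\<close>, as every algorithm in \<open>correct_algorithms\<close> does.\<close>

definition cost :: "real \<Rightarrow> 'o algorithm \<Rightarrow> 'o database \<Rightarrow> real" where
  "cost c\<^sub>S A D = real (LEAST s. \<exists>Y. outputs_after A D s Y) * c\<^sub>S"

definition correct_algorithms :: "nat \<Rightarrow> nat \<Rightarrow> (real list \<Rightarrow> real) \<Rightarrow> 'o algorithm set" where
  "correct_algorithms m k t =
     {A. \<forall>D\<in>databases m k. \<exists>s Y. outputs_after A D s Y \<and> top_k m k t D Y}"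

definition instance_optimal ::
    "('a \<Rightarrow> 'd \<Rightarrow> real) \<Rightarrow> 'a \<Rightarrow> 'a set \<Rightarrow> 'd set \<Rightarrow> bool" where
  "instance_optimal cst B AA DD \<longleftrightarrow>
     B \<in> AA \<and> (\<exists>c c'. \<forall>A\<in>AA. \<forall>D\<in>DD. cst B D \<le> c * cst A D + c')"


section \<open>The algorithm NRA\<close>

definition seen :: "'o history \<Rightarrow> 'o set" where
  "seen h = {R. \<exists>i x. (i, Some (R, x)) \<in> set h}"

definition known_fields :: "'o history \<Rightarrow> 'o \<Rightarrow> nat set" where
  "known_fields h R = {i. \<exists>x. (i, Some (R, x)) \<in> set h}"

definition known_value :: "'o history \<Rightarrow> 'o \<Rightarrow> nat \<Rightarrow> real" where
  "known_value h R i = (THE x. (i, Some (R, x)) \<in> set h)"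

definition bottom_value :: "'o history \<Rightarrow> nat \<Rightarrow> real" where
  "bottom_value h i = snd (last (entries_read h i))"

definition W :: "nat \<Rightarrow> (real list \<Rightarrow> real) \<Rightarrow> 'o history \<Rightarrow> 'o \<Rightarrow> real" where
  "W m t h R =
     t (map (\<lambda>i. if i \<in> known_fields h R then known_value h R i else 0) [0..<m])"

definition B :: "nat \<Rightarrow> (real list \<Rightarrow> real) \<Rightarrow> 'o history \<Rightarrow> 'o \<Rightarrow> real" where
  "B m t h R =
     t (map (\<lambda>i. if i \<in> known_fields h R then known_value h R i else bottom_value h i) [0..<m])"

definition is_T :: "nat \<Rightarrow> nat \<Rightarrow> (real list \<Rightarrow> real) \<Rightarrow> 'o history \<Rightarrow> 'o set \<Rightarrow> bool" where
  "is_T m k t h T \<longleftrightarrow> T \<subseteq> seen h \<and> card T = k \<and>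
     (\<forall>R\<in>T. \<forall>R'\<in>seen h - T.
        W m t h R' < W m t h R \<or> (W m t h R' = W m t h R \<and> B m t h R' \<le> B m t h R))"

text \<open>The remaining ties in the choice of $T_k$ are broken arbitrarily: \<open>sel\<close> is any function
  making a legal choice. There is none to make while fewer than \<open>k\<close> objects have been seen.\<close>

definition T_selection ::
    "nat \<Rightarrow> nat \<Rightarrow> (real list \<Rightarrow> real) \<Rightarrow> ('o set \<Rightarrow> 'o history \<Rightarrow> 'o set) \<Rightarrow> bool" where
  "T_selection m k t sel \<longleftrightarrow>
     (\<forall>Os h. k \<le> card (seen h) \<longrightarrow> is_T m k t h (sel Os h))"

text \<open>Since $T_k$ has exactly \<open>k\<close> elements, the \<open>k\<close>th largest \<open>W\<close> value in it is the least one.\<close>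

definition M :: "nat \<Rightarrow> (real list \<Rightarrow> real) \<Rightarrow> 'o history \<Rightarrow> 'o set \<Rightarrow> real" where
  "M m t h T = Min (W m t h ` T)"

text \<open>The lists are accessed round-robin, so depth \<open>d\<close> is reached after \<open>d * m\<close> accesses; the halting
  rule is tested only when all lists have been read to the same depth.\<close>

definition NRA ::
    "nat \<Rightarrow> nat \<Rightarrow> (real list \<Rightarrow> real) \<Rightarrow> ('o set \<Rightarrow> 'o history \<Rightarrow> 'o set) \<Rightarrow> 'o algorithm" where
  "NRA m k t sel Os h =
     (let T = sel Os h in
      if m dvd length h \<and> k \<le> card (seen h) \<and> (\<forall>R\<in>Os - T. B m t h R \<le> M m t h T)
      then Output T else Access (length h mod m))"

end

theory Submission
  imports Defs
begin

text \<open>Let \<open>A\<close> be a correct algorithm that halts on \<open>D\<close> after \<open>s\<close> accesses with output \<open>Y\<close>, and let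
  \<open>d = max s k\<close>. If \<open>d\<close> is smaller than the number of objects, then for each object \<open>R\<close> there is a
  database that agrees with \<open>D\<close> to depth \<open>d\<close>, in which the unknown fields of \<open>R\<close> are the bottom
  values and all other unknown fields are \<open>0\<close>. As \<open>A\<close> cannot tell it from \<open>D\<close>, correctness of \<open>A\<close>
  on it forces \<open>B(R) \<le> W(R')\<close> for \<open>R \<notin> Y\<close> and \<open>R' \<in> Y\<close>. This implies the halting rule of NRA at
  depth \<open>d\<close>, the tie-breaking by \<open>B\<close> being essential when \<open>R \<in> Y - T\<close>. If \<open>d\<close> is at least the number of
  objects, NRA has read everything. So NRA makes at most \<open>m * (s + k)\<close> accesses; the additive
  constant is needed because \<open>A\<close> may output objects that it has not seen.\<close>

section \<open>Histories\<close>

lemma entries_read_Nil [simp]: "entries_read [] i = []"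
  by (simp add: entries_read_def)

lemma entries_read_snoc:
  "entries_read (h @ [(i, r)]) j =
     entries_read h j @ (if i = j then (case r of None \<Rightarrow> [] | Some p \<Rightarrow> [p]) else [])"
  by (auto simp: entries_read_def split: option.splits)

lemma mem_history_iff: "(i, Some p) \<in> set h \<longleftrightarrow> p \<in> set (entries_read h i)"
  by (induction h) (auto simp: entries_read_def)

lemma length_entries_read: "length (entries_read h i) \<le> length h"
proof (induction h rule: rev_induct)
  case (snoc a h)
  then show ?case by (cases a) (auto simp: entries_read_snoc split: option.splits)
qed simp

lemma seen_iff: "R \<in> seen h \<longleftrightarrow> known_fields h R \<noteq> {}"
  by (auto simp: seen_def known_fields_def)

lemma length_history_after: "length (history_after A D n) \<le> n"
  by (induction n) (auto simp: Let_def split: action.splits)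

lemma outputs_after_mono:
  assumes "outputs_after A D s Y" and "s \<le> s'"
  shows "outputs_after A D s' Y"
proof -
  have "history_after A D s' = history_after A D s"
    using assms(2)
  proof (induction rule: dec_induct)
    case (step n)
    then show ?case using assms(1) by (simp add: outputs_after_def Let_def)
  qed simp
  then show ?thesis using assms(1) by (simp add: outputs_after_def)
qed

lemma outputs_after_unique:
  assumes "outputs_after A D s Y" and "outputs_after A D s' Y'"
  shows "Y = Y'"
  using outputs_after_mono[OF assms(1), of "max s s'"] outputs_after_mono[OF assms(2), of "max s s'"]
  by (simp add: outputs_after_def)

text \<open>Before each of the first \<open>n \<le> d\<close> accesses, fewer than \<open>d\<close>
  entries of any list have been read, so every answer from an existing list lies in the common
  prefix and is never \<open>None\<close>.\<close>

lemma history_after_cong: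
  assumes "objs D' = objs D" and "length (slists D') = length (slists D)"
    and "\<And>i. i < length (slists D) \<Longrightarrow>
           d \<le> length (slists D ! i) \<and> d \<le> length (slists D' ! i) \<and>
           take d (slists D' ! i) = take d (slists D ! i)"
    and "n \<le> d"
  shows "history_after A D' n = history_after A D n"
  using assms(4)
proof (induction n)
  case (Suc n)
  define h where "h = history_after A D n"
  have "next_entry D' h i = next_entry D h i" for i
  proof -
    have len: "length (entries_read h i) < d"
      using length_entries_read[of h i] length_history_after[of A D n] Suc.prems h_def by simp
    show ?thesis
    proof (cases "i < length (slists D)")
      case True
      then have "slists D' ! i ! length (entries_read h i) = slists D ! i ! length (entries_read h i)"
        using assms(3)[OF True] len by (metis nth_take)
      then show ?thesis
        using assms(2) assms(3)[OF True] len by (simp add: next_entry_def)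
    qed (use assms(2) in \<open>simp add: next_entry_def\<close>)
  qed
  then show ?case
    using Suc assms(1) h_def by (simp add: Let_def split: action.splits)
qed simp

section \<open>Sorted lists read to a common depth\<close>

text \<open>Fixes what has been read of each list, not the order of accesses. A depth beyond the end
  of a list means that the whole list has been read.\<close>

definition read_to_depth :: "nat \<Rightarrow> 'o database \<Rightarrow> nat \<Rightarrow> 'o history \<Rightarrow> bool" where
  "read_to_depth m D d h \<longleftrightarrow>
     (\<forall>i. entries_read h i = (if i < m then take d (slists D ! i) else []))"

text \<open>Round-robin counting: until NRA halts, every list has been accessed
  \<open>n div m\<close> times, and the first \<open>n mod m\<close> lists once more.\<close>

lemma NRA_history:
  assumes "m > 0" and len: "length (slists D) = m"
    and "\<And>n' Y. n' < n \<Longrightarrow> \<not> outputs_after (NRA m k t sel) D n' Y"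
  shows "length (history_after (NRA m k t sel) D n) = n \<and>
    (\<forall>i. entries_read (history_after (NRA m k t sel) D n) i =
       (if i < m then take (n div m + of_bool (i < n mod m)) (slists D ! i) else []))"
  using assms(3)
proof (induction n)
  case (Suc n)
  let ?A = "NRA m k t sel"
  define h where "h = history_after ?A D n"
  have IH: "length h = n"
    "\<And>i. entries_read h i = (if i < m then take (n div m + of_bool (i < n mod m)) (slists D ! i) else [])"
    using Suc h_def by (metis less_SucI)+
  have "?A (objs D) h \<noteq> Output Y" for Y
    using Suc.prems[of n Y] by (simp add: outputs_after_def h_def)
  then have "?A (objs D) h = Access (n mod m)"
    using IH(1) unfolding NRA_def Let_def by metis
  then have step: "history_after ?A D (Suc n) = h @ [(n mod m, next_entry D h (n mod m))]"
    by (simp add: h_def[symmetric] Let_def)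
  have nm: "n mod m < m" using \<open>m > 0\<close> by simp
  \<comment> \<open>If the list is exhausted, the answer is \<open>None\<close> and the longer
    \<open>take\<close> adds nothing.\<close>
  have new: "entries_read h (n mod m) @ (case next_entry D h (n mod m) of None \<Rightarrow> [] | Some p \<Rightarrow> [p])
      = take (Suc (n div m)) (slists D ! (n mod m))"
    using nm len by (auto simp: next_entry_def IH(2) take_Suc_conv_app_nth min_def)
  have "entries_read (history_after ?A D (Suc n)) i =
       (if i < m then take (Suc n div m + of_bool (i < Suc n mod m)) (slists D ! i) else [])" for i
  proof (cases "i = n mod m")
    case True
    \<comment> \<open>Either the remainder wraps to 0 and the quotient grows, or the
      \<open>of_bool\<close> term becomes 1.\<close>
    then have "Suc n div m + of_bool (i < Suc n mod m) = Suc (n div m)"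
      using nm by (auto simp: div_Suc mod_Suc)
    then show ?thesis using True new nm unfolding step by (simp add: entries_read_snoc)
  next
    case False
    then have "Suc n div m + of_bool (i < Suc n mod m) = n div m + of_bool (i < n mod m)" if "i < m"
      using nm that by (auto simp: div_Suc mod_Suc)
    then show ?thesis using False unfolding step by (simp add: entries_read_snoc IH(2))
  qed
  then show ?case unfolding step by (simp add: IH(1))
qed simp

lemma databasesD:
  assumes "D \<in> databases m k"
  shows "finite (objs D)" "k \<le> card (objs D)" "length (slists D) = m"
    and "\<And>R i. R \<in> objs D \<Longrightarrow> i < m \<Longrightarrow> 0 \<le> grade D R i \<and> grade D R i \<le> 1"
    and "\<And>i. i < m \<Longrightarrow> distinct (slists D ! i)"
    and "\<And>i. i < m \<Longrightarrow> set (slists D ! i) = (\<lambda>R. (R, grade D R i)) ` objs D"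
    and "\<And>i. i < m \<Longrightarrow> sorted_wrt (\<lambda>p q. snd p \<ge> snd q) (slists D ! i)"
  using assms by (auto simp: databases_def)

lemma length_slist:
  assumes "D \<in> databases m k" and "i < m"
  shows "length (slists D ! i) = card (objs D)"
proof -
  have "inj_on (\<lambda>R. (R, grade D R i)) (objs D)" by (auto simp: inj_on_def)
  then show ?thesis
    using databasesD(5,6)[OF assms] distinct_card card_image by metis
qed

context
  fixes m k d :: nat and D :: "'o database" and h :: "'o history"
  assumes D: "D \<in> databases m k" and h: "read_to_depth m D d h"
begin

lemma mem_slist_prefix:
  assumes "i < m" and "(R, x) \<in> set (take d (slists D ! i))"
  shows "R \<in> objs D" "x = grade D R i"
  using in_set_takeD[OF assms(2)] databasesD(6)[OF D assms(1)] by auto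

lemma mem_history_iff_prefix:
  "(i, Some p) \<in> set h \<longleftrightarrow> i < m \<and> p \<in> set (take d (slists D ! i))"
  using h by (simp add: mem_history_iff read_to_depth_def)

lemma known_fields_iff:
  "i \<in> known_fields h R \<longleftrightarrow> i < m \<and> (R, grade D R i) \<in> set (take d (slists D ! i))"
  unfolding known_fields_def mem_history_iff_prefix
  using mem_slist_prefix(2)[of i R] by blast

lemma known_value_eq: "i \<in> known_fields h R \<Longrightarrow> known_value h R i = grade D R i"
  unfolding known_value_def mem_history_iff_prefix known_fields_iff
  using mem_slist_prefix(2)[of i R] by (intro the_equality) blast+

lemma known_fields_objs: "i \<in> known_fields h R \<Longrightarrow> R \<in> objs D"
  unfolding known_fields_iff using mem_slist_prefix(1)[of i R "grade D R i"] by blast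

lemma seen_subset: "seen h \<subseteq> objs D"
  by (auto simp: seen_iff intro: known_fields_objs)

lemma finite_seen: "finite (seen h)"
  using finite_subset[OF seen_subset databasesD(1)[OF D]] .

text \<open>List 0 suffices: an object determines its entry there, so distinct entries name distinct
  objects.\<close>

lemma k_le_card_seen:
  assumes "0 < m" and "k \<le> d"
  shows "k \<le> card (seen h)"
proof -
  let ?P = "set (take d (slists D ! 0))"
  have "inj_on fst ?P"
    using mem_slist_prefix(2)[OF \<open>0 < m\<close>] by (intro inj_onI) (metis prod.collapse)
  then have "card (fst ` ?P) = length (take d (slists D ! 0))"
    using databasesD(5)[OF D \<open>0 < m\<close>] by (simp add: card_image distinct_card)
  then have "k \<le> card (fst ` ?P)"
    using assms databasesD(2)[OF D] length_slist[OF D \<open>0 < m\<close>] by simp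
  moreover have "fst ` ?P \<subseteq> seen h"
    using \<open>0 < m\<close> unfolding seen_def mem_history_iff_prefix by fastforce
  ultimately show ?thesis using card_mono[OF finite_seen] le_trans by blast
qed

text \<open>The prefix is nonempty, so \<open>last\<close> is a genuine entry; as the list is
  descending, it separates the grades already read from the unread ones.\<close>

lemma bottom_value_bounds:
  assumes "0 < d" and "i < m" and "objs D \<noteq> {}"
  shows "0 \<le> bottom_value h i" "bottom_value h i \<le> 1"
    and "i \<in> known_fields h R \<Longrightarrow> bottom_value h i \<le> grade D R i"
    and "R \<in> objs D \<Longrightarrow> i \<notin> known_fields h R \<Longrightarrow> grade D R i \<le> bottom_value h i"
proof -
  let ?L = "slists D ! i" and ?b = "last (take d (slists D ! i))"
  have ne: "take d ?L \<noteq> []"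
    using assms databasesD(6)[OF D \<open>i < m\<close>] by auto
  have b: "bottom_value h i = snd ?b"
    using h \<open>i < m\<close> by (simp add: bottom_value_def read_to_depth_def)
  have mem: "?b \<in> set (take d ?L)" using ne by simp
  then have "?b \<in> (\<lambda>R. (R, grade D R i)) ` objs D"
    using databasesD(6)[OF D \<open>i < m\<close>] in_set_takeD by fastforce
  then show "0 \<le> bottom_value h i" "bottom_value h i \<le> 1"
    using databasesD(4)[OF D _ \<open>i < m\<close>] b by auto
  have sorted: "sorted_wrt (\<lambda>p q. snd p \<ge> snd q) (take d ?L @ drop d ?L)"
    using databasesD(7)[OF D \<open>i < m\<close>] by simp
  show "bottom_value h i \<le> grade D R i" if "i \<in> known_fields h R"
  proof -
    have "sorted_wrt (\<lambda>p q. snd p \<ge> snd q) (butlast (take d ?L) @ [?b])"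
      using sorted ne by (simp add: sorted_wrt_append)
    moreover have "(R, grade D R i) \<in> set (butlast (take d ?L) @ [?b])"
      using that ne known_fields_iff by simp
    ultimately show ?thesis by (auto simp: b sorted_wrt_append dest: arg_cong[of _ _ snd])
  qed
  show "grade D R i \<le> bottom_value h i" if "R \<in> objs D" "i \<notin> known_fields h R"
  proof -
    have "(R, grade D R i) \<in> set (take d ?L @ drop d ?L)"
      using databasesD(6)[OF D \<open>i < m\<close>] that by simp
    then have "(R, grade D R i) \<in> set (drop d ?L)"
      using that \<open>i < m\<close> known_fields_iff by (metis Un_iff set_append)
    then show ?thesis using sorted mem unfolding b sorted_wrt_append by fastforce
  qed
qed

end

section \<open>Worst and best grades\<close>

lemma monotone_aggregationD:
  assumes "monotone_aggregation m t"
    and "\<And>i. i < m \<Longrightarrow> 0 \<le> f i \<and> f i \<le> g i \<and> g i \<le> 1"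
  shows "t (map f [0..<m]) \<le> t (map g [0..<m])"
proof -
  have "map f [0..<m] \<in> unit_cube m" "map g [0..<m] \<in> unit_cube m"
    using assms(2) by (force simp: unit_cube_def)+
  then show ?thesis using assms by (simp add: monotone_aggregation_def)
qed

lemma is_T_D:
  assumes "is_T m k t h T" and "R \<in> T" and "R' \<in> seen h" and "R' \<notin> T"
  shows "W m t h R' \<le> W m t h R" "W m t h R' = W m t h R \<Longrightarrow> B m t h R' \<le> B m t h R"
proof -
  have "W m t h R' < W m t h R \<or> W m t h R' = W m t h R \<and> B m t h R' \<le> B m t h R"
    using assms unfolding is_T_def by blast
  then show "W m t h R' \<le> W m t h R" "W m t h R' = W m t h R \<Longrightarrow> B m t h R' \<le> B m t h R"
    by auto
qed

lemma M_least:
  assumes "is_T m k t h T" and "0 < k"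
  obtains P where "P \<in> T" "M m t h T = W m t h P" "\<And>R. R \<in> T \<Longrightarrow> M m t h T \<le> W m t h R"
proof -
  have "finite T" "T \<noteq> {}"
    using assms by (auto simp: is_T_def intro: card_ge_0_finite)
  then have "Min (W m t h ` T) \<in> W m t h ` T" by (intro Min_in) auto
  then obtain P where "P \<in> T" "M m t h T = W m t h P" by (auto simp: M_def)
  moreover have "M m t h T \<le> W m t h R" if "R \<in> T" for R
    using that \<open>finite T\<close> by (simp add: M_def)
  ultimately show ?thesis using that by blast
qed

context
  fixes m k d :: nat and D :: "'o database" and h :: "'o history" and t :: "real list \<Rightarrow> real"
  assumes D: "D \<in> databases m k" and h: "read_to_depth m D d h"
    and mono: "monotone_aggregation m t" and m: "0 < m" and k: "0 < k" and d: "0 < d"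
begin

lemma objs_nonempty: "objs D \<noteq> {}"
  using databasesD(2)[OF D] k by auto

lemmas bounds = bottom_value_bounds[OF D h d _ objs_nonempty]

lemmas grade_bounds = databasesD(4)[OF D]

section \<open>Grade bounds at a fixed depth\<close>

lemma W_le_overall:
  assumes "R \<in> objs D"
  shows "W m t h R \<le> overall m t D R"
  unfolding W_def overall_def
  using grade_bounds[OF assms] known_value_eq[OF D h]
  by (intro monotone_aggregationD[OF mono]) auto

lemma overall_le_B:
  assumes "R \<in> objs D"
  shows "overall m t D R \<le> B m t h R"
  unfolding B_def overall_def
  using grade_bounds[OF assms] known_value_eq[OF D h] bounds(2,4) assms
  by (intro monotone_aggregationD[OF mono]) auto

lemma W_le_B:
  assumes "R \<in> objs D"
  shows "W m t h R \<le> B m t h R"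
  using W_le_overall overall_le_B assms by fastforce

lemma W_unseen_le:
  assumes "R \<notin> seen h" and "R' \<in> objs D"
  shows "W m t h R \<le> W m t h R'"
  unfolding W_def
  using grade_bounds[OF assms(2)] known_value_eq[OF D h] assms(1)
  by (intro monotone_aggregationD[OF mono]) (auto simp: seen_iff)

text \<open>An unseen object gets the bottom value in every field, and the known grades of any other
  object are no smaller.\<close>

lemma B_unseen_le:
  assumes "R \<notin> seen h" and "R' \<in> objs D"
  shows "B m t h R \<le> B m t h R'"
  unfolding B_def
  using grade_bounds[OF assms(2)] known_value_eq[OF D h] bounds assms(1)
  by (intro monotone_aggregationD[OF mono]) (auto simp: seen_iff)

section \<open>Soundness of the halting rule, and conditions that trigger it\<close>

text \<open>\<open>M\<close> separates the two sides: it is at least \<open>B\<close> outside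
  \<open>T\<close> and at most \<open>W\<close> inside, and overall grades lie between
  \<open>W\<close> and \<open>B\<close>.\<close>

lemma top_k_if_halted:
  assumes T: "is_T m k t h T" and halt: "\<And>R. R \<in> objs D - T \<Longrightarrow> B m t h R \<le> M m t h T"
  shows "top_k m k t D T"
proof -
  have sub: "T \<subseteq> objs D" "card T = k"
    using T seen_subset[OF D h] by (auto simp: is_T_def)
  have "overall m t D R' \<le> overall m t D R" if "R \<in> T" "R' \<in> objs D - T" for R R'
  proof -
    have "overall m t D R' \<le> B m t h R'" using overall_le_B that by blast
    also have "\<dots> \<le> M m t h T" using halt that by blast
    also have "\<dots> \<le> W m t h R" using M_least[OF T k] that by metis
    also have "\<dots> \<le> overall m t D R" using W_le_overall that sub by blast
    finally show ?thesis .
  qed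
  with sub show ?thesis by (auto simp: top_k_def)
qed

text \<open>With every field known, \<open>B\<close> and \<open>W\<close> coincide, and the choice
  of \<open>T\<close> already orders objects by \<open>W\<close>.\<close>

lemma halted_if_all_read:
  assumes "card (objs D) \<le> d" and T: "is_T m k t h T" and R: "R \<in> objs D - T"
  shows "B m t h R \<le> M m t h T"
proof -
  have kf: "i \<in> known_fields h R" if "i < m" for i
    using that assms(1) R known_fields_iff[OF D h] length_slist[OF D that] databasesD(6)[OF D that]
    by simp
  obtain P where P: "P \<in> T" "M m t h T = W m t h P" using M_least[OF T k] by metis
  have "R \<in> seen h" using kf[OF m] by (auto simp: seen_iff)
  moreover have "B m t h R = W m t h R"
    unfolding B_def W_def using kf by (intro arg_cong[of _ _ t]) simp
  ultimately show ?thesis using is_T_D(1)[OF T P(1)] P R by auto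
qed

text \<open>\<open>T\<close> and \<open>Y\<close> have equal size, so if they differ, each has a
  member outside the other. Comparing a violator \<open>R\<close> of the halting rule with such a
  member gives the contradiction.\<close>

lemma halted_if_separated:
  assumes T: "is_T m k t h T" and Y: "Y \<subseteq> objs D" "card Y = k"
    and sep: "\<And>R R'. R \<in> objs D - Y \<Longrightarrow> R' \<in> Y \<Longrightarrow> B m t h R \<le> W m t h R'"
    and R: "R \<in> objs D - T"
  shows "B m t h R \<le> M m t h T"
proof (rule ccontr)
  assume less: "\<not> ?thesis"
  obtain P where P: "P \<in> T" "M m t h T = W m t h P" and least: "\<And>R. R \<in> T \<Longrightarrow> M m t h T \<le> W m t h R"
    using M_least[OF T k] by metis
  have T_sub: "T \<subseteq> objs D" and T_card: "card T = k"
    using T seen_subset[OF D h] by (auto simp: is_T_def)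
  have fin: "finite T" "finite Y"
    using T_card Y(2) k by (auto intro: card_ge_0_finite)
  show False
  proof (cases "R \<in> Y")
    case False
    have gt: "W m t h P < W m t h R'" if "R' \<in> Y" for R'
      using sep[of R R'] False R that less P by auto
    then have "P \<notin> Y" by blast
    then obtain Q where Q: "Q \<in> Y" "Q \<notin> T"
      using P(1) fin T_card Y(2) by (metis card_subset_eq subsetI)
    \<comment> \<open>An unseen object has the least possible \<open>W\<close>, so \<open>Q\<close>
      must be seen; then its larger \<open>W\<close> conflicts with \<open>P\<close> being chosen
      for \<open>T\<close> instead.\<close>
    have "Q \<in> seen h" using W_unseen_le[of Q P] gt[OF Q(1)] P(1) T_sub by fastforce
    then show False using is_T_D(1)[OF T P(1)] Q gt by fastforce
  next
    case True
    then obtain Q where Q: "Q \<in> T" "Q \<notin> Y"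
      using R fin T_card Y(2) by (metis card_subset_eq subsetI DiffD2)
    have Q_objs: "Q \<in> objs D" using Q T_sub by blast
    have BQ: "B m t h Q \<le> W m t h R" using sep[of Q R] Q Q_objs True by blast
    show False
    proof (cases "R \<in> seen h")
      case True
      \<comment> \<open>The chain \<open>W R \<le> W P \<le> W Q \<le> B Q \<le> W R\<close> closes
        up, so \<open>R\<close> and \<open>Q\<close> tie in \<open>W\<close> and the tie-break by
        \<open>B\<close> applies.\<close>
      have "W m t h R \<le> W m t h P" using is_T_D(1)[OF T P(1) True] R by blast
      moreover have "W m t h P \<le> W m t h Q" using least Q P by simp
      moreover have "W m t h Q \<le> B m t h Q" using W_le_B Q_objs by blast
      ultimately have "B m t h R \<le> B m t h Q"
        using is_T_D(2)[OF T Q(1) True] BQ R by auto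
      then show False
        using BQ \<open>W m t h R \<le> W m t h P\<close> P less by simp
    next
      case False
      have "B m t h R \<le> B m t h Q" using B_unseen_le False Q_objs by blast
      also have "\<dots> \<le> W m t h P" using BQ W_unseen_le[OF False, of P] P T_sub by fastforce
      finally show False using less P by simp
    qed
  qed
qed

section \<open>The adversary argument\<close>

text \<open>Each new list is the prefix read so far, then \<open>R\<close> at the bottom value if it
  is not yet there, then the remaining objects at 0. Known grades are at least the bottom value,
  which is at least 0, so the list stays sorted. Thus \<open>R\<close> attains its best grade while
  all others attain their worst.\<close>

lemma extremal_database:
  assumes R: "R \<in> objs D" and "d \<le> card (objs D)"
  obtains D' where "D' \<in> databases m k" "objs D' = objs D"
    and "\<And>i. i < m \<Longrightarrow> take d (slists D' ! i) = take d (slists D ! i)"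
    and "overall m t D' R = B m t h R"
    and "\<And>R'. R' \<in> objs D \<Longrightarrow> R' \<noteq> R \<Longrightarrow> overall m t D' R' = W m t h R'"
proof -
  define g where "g = (\<lambda>P i. if i \<in> known_fields h P then grade D P i
                             else if P = R then bottom_value h i else 0)"
  define unread where "unread = (\<lambda>i. {P \<in> objs D. i \<notin> known_fields h P \<and> P \<noteq> R})"
  \<comment> \<open>Any enumeration serves, since these objects all tie at grade 0.\<close>
  define zs where "zs = (\<lambda>i. SOME ys. set ys = unread i \<and> distinct ys)"
  have zs: "set (zs i) = unread i \<and> distinct (zs i)" for i
  proof -
    have "finite (unread i)" using databasesD(1)[OF D] by (simp add: unread_def)
    then have "\<exists>ys. set ys = unread i \<and> distinct ys" by (rule finite_distinct_list)
    then show ?thesis unfolding zs_def by (rule someI_ex)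
  qed
  define L where "L = (\<lambda>i. take d (slists D ! i) @
      (if i \<in> known_fields h R then [] else [(R, bottom_value h i)]) @ map (\<lambda>P. (P, 0)) (zs i))"
  define D' where "D' = \<lparr>objs = objs D, grade = g, slists = map L [0..<m]\<rparr>"
  have L: "distinct (L i) \<and> set (L i) = (\<lambda>P. (P, g P i)) ` objs D \<and>
      sorted_wrt (\<lambda>p q. snd p \<ge> snd q) (L i)" if i: "i < m" for i
  proof -
    have prefix: "(P, x) \<in> set (take d (slists D ! i)) \<longleftrightarrow> i \<in> known_fields h P \<and> x = grade D P i" for P x
      by (metis known_fields_iff[OF D h] mem_slist_prefix(2)[OF D h i] i)
    have mem_zs: "P \<in> set (zs i) \<longleftrightarrow> P \<in> objs D \<and> i \<notin> known_fields h P \<and> P \<noteq> R" for P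
      using zs by (simp add: unread_def)
    have "distinct (L i)"
      using databasesD(5)[OF D i] zs[of i]
      by (auto simp: L_def prefix distinct_map inj_on_def mem_zs)
    moreover have "set (L i) = (\<lambda>P. (P, g P i)) ` objs D"
    proof (intro set_eqI)
      fix p :: "'o \<times> real"
      obtain P x where p: "p = (P, x)" by fastforce
      show "p \<in> set (L i) \<longleftrightarrow> p \<in> (\<lambda>P. (P, g P i)) ` objs D"
        using R known_fields_objs[OF D h, of i P]
        by (auto simp: p L_def g_def prefix mem_zs image_iff)
    qed
    moreover have "sorted_wrt (\<lambda>p q. snd p \<ge> snd q) (L i)"
    proof -
      have "sorted_wrt (\<lambda>p q. snd p \<ge> snd q) (take d (slists D ! i) @ drop d (slists D ! i))"
        using databasesD(7)[OF D i] by simp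
      then have "sorted_wrt (\<lambda>p q. snd p \<ge> snd q) (take d (slists D ! i))"
        unfolding sorted_wrt_append by blast
      moreover have "sorted_wrt (\<lambda>p q. snd p \<ge> snd q) (map (\<lambda>P. (P, 0::real)) (zs i))"
        by (simp add: sorted_wrt_map sorted_wrt_iff_nth_less)
      ultimately show ?thesis
        using bounds(1,3)[OF i] grade_bounds[OF known_fields_objs[OF D h] i]
        by (auto simp: L_def sorted_wrt_append prefix)
    qed
    ultimately show ?thesis by blast
  qed
  have g: "0 \<le> g P i \<and> g P i \<le> 1" if "P \<in> objs D" "i < m" for P i
    using grade_bounds[OF that] bounds(1,2)[OF that(2)] by (simp add: g_def)
  show ?thesis
  proof (rule that)
    show "D' \<in> databases m k"
      using databasesD(1,2)[OF D] L g by (simp add: databases_def D'_def)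
    show "objs D' = objs D" by (simp add: D'_def)
    \<comment> \<open>As \<open>d \<le> card (objs D)\<close>, the old prefix has length exactly
      \<open>d\<close>, so \<open>take d\<close> drops precisely the appended entries.\<close>
    show "take d (slists D' ! i) = take d (slists D ! i)" if "i < m" for i
      using that assms(2) length_slist[OF D that] by (simp add: D'_def L_def)
    show "overall m t D' R = B m t h R"
      unfolding overall_def B_def D'_def g_def using known_value_eq[OF D h]
      by (intro arg_cong[of _ _ t]) simp
    show "overall m t D' R' = W m t h R'" if "R' \<noteq> R" for R'
      unfolding overall_def W_def D'_def g_def using known_value_eq[OF D h] that
      by (intro arg_cong[of _ _ t]) simp
  qed
qed

lemma correct_output_separated:
  assumes A: "A \<in> correct_algorithms m k t" and out: "outputs_after A D s Y"
    and "s \<le> d" and dN: "d \<le> card (objs D)"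
    and R: "R \<in> objs D - Y" and R': "R' \<in> Y" and Y: "Y \<subseteq> objs D"
  shows "B m t h R \<le> W m t h R'"
proof -
  obtain D' where D': "D' \<in> databases m k" "objs D' = objs D"
    and take: "\<And>i. i < m \<Longrightarrow> take d (slists D' ! i) = take d (slists D ! i)"
    and RB: "overall m t D' R = B m t h R"
    and RW: "\<And>R'. R' \<in> objs D \<Longrightarrow> R' \<noteq> R \<Longrightarrow> overall m t D' R' = W m t h R'"
    using extremal_database[of R] R dN by blast
  have "history_after A D' s = history_after A D s"
    using D' take dN \<open>s \<le> d\<close> length_slist[OF D] length_slist[OF D'(1)]
      databasesD(3)[OF D] databasesD(3)[OF D'(1)]
    by (intro history_after_cong[where d = d]) auto
  then have "outputs_after A D' s Y"
    using out D'(2) by (simp add: outputs_after_def)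
  moreover obtain s' Y' where "outputs_after A D' s' Y'" "top_k m k t D' Y'"
    using A D'(1) by (auto simp: correct_algorithms_def)
  \<comment> \<open>Correctness promises only some top-k output on \<open>D'\<close>; uniqueness of
    outputs identifies it with \<open>Y\<close>.\<close>
  ultimately have "top_k m k t D' Y" using outputs_after_unique by metis
  then have "overall m t D' R \<le> overall m t D' R'"
    using R R' D'(2) by (auto simp: top_k_def)
  moreover have "R' \<in> objs D" "R' \<noteq> R" using R R' Y by auto
  ultimately show ?thesis using RB RW by simp
qed

end

section \<open>Instance optimality\<close>

context
  fixes m k :: nat and t :: "real list \<Rightarrow> real" and sel :: "'o set \<Rightarrow> 'o history \<Rightarrow> 'o set"
    and D :: "'o database"
  assumes m: "0 < m" and k: "0 < k" and mono: "monotone_aggregation m t"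
    and sel: "T_selection m k t sel" and D: "D \<in> databases m k"
begin

text \<open>Unless NRA stops earlier, depth \<open>d\<close> is reached after \<open>d * m\<close>
  accesses and the test succeeds there. Quantifying over all \<open>h\<close> and \<open>T\<close>
  covers every choice made by \<open>sel\<close>.\<close>

lemma NRA_halts_by:
  assumes "k \<le> d"
    and halted: "\<And>h T R. read_to_depth m D d h \<Longrightarrow> is_T m k t h T \<Longrightarrow> R \<in> objs D - T \<Longrightarrow>
      B m t h R \<le> M m t h T"
  shows "\<exists>s\<le>d * m. \<exists>Y. outputs_after (NRA m k t sel) D s Y"
proof (rule ccontr)
  let ?h = "history_after (NRA m k t sel) D (d * m)"
  assume none: "\<not> ?thesis"
  then have hist: "length ?h = d * m" "read_to_depth m D d ?h"
    using NRA_history[OF m databasesD(3)[OF D], of "d * m" k t sel] m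
    by (auto simp: read_to_depth_def)
  have seen: "k \<le> card (seen ?h)" using k_le_card_seen[OF D hist(2) m \<open>k \<le> d\<close>] .
  then have "is_T m k t ?h (sel (objs D) ?h)" using sel by (simp add: T_selection_def)
  then have "outputs_after (NRA m k t sel) D (d * m) (sel (objs D) ?h)"
    using halted hist seen by (simp add: outputs_after_def NRA_def Let_def)
  with none show False by blast
qed

lemma NRA_halts:
  "\<exists>s\<le>card (objs D) * m. \<exists>Y. outputs_after (NRA m k t sel) D s Y"
proof (rule NRA_halts_by)
  show "k \<le> card (objs D)" using databasesD(2)[OF D] .
  then have "0 < card (objs D)" using k by simp
  then show "B m t h R \<le> M m t h T"
    if "read_to_depth m D (card (objs D)) h" "is_T m k t h T" "R \<in> objs D - T" for h T R
    using halted_if_all_read[OF D that(1) mono m k] that(2,3) by blast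
qed

text \<open>NRA can stop only at a multiple of \<open>m\<close>, so at its first halting time all
  lists are read to one common depth and soundness applies.\<close>

lemma NRA_top_k: "\<exists>s Y. outputs_after (NRA m k t sel) D s Y \<and> top_k m k t D Y"
proof -
  let ?A = "NRA m k t sel"
  define s where "s = (LEAST s. \<exists>Y. outputs_after ?A D s Y)"
  obtain Y where Y: "outputs_after ?A D s Y"
    using LeastI_ex[of "\<lambda>s. \<exists>Y. outputs_after ?A D s Y"] NRA_halts unfolding s_def by auto
  have "\<not> outputs_after ?A D n Y'" if "n < s" for n Y'
    using that not_less_Least unfolding s_def by blast
  note NRA_history[OF m databasesD(3)[OF D] this]
  then have hist: "length (history_after ?A D s) = s"
    "\<And>i. entries_read (history_after ?A D s) i =
       (if i < m then take (s div m + of_bool (i < s mod m)) (slists D ! i) else [])"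
    by simp_all
  define h where "h = history_after ?A D s"
  have out: "m dvd s" "k \<le> card (seen h)" "Y = sel (objs D) h"
    "\<And>R. R \<in> objs D - Y \<Longrightarrow> B m t h R \<le> M m t h Y"
    using Y hist(1) by (auto simp: outputs_after_def NRA_def Let_def h_def split: if_splits)
  have rd: "read_to_depth m D (s div m) h"
    using hist(2) out(1) by (simp add: read_to_depth_def h_def)
  \<comment> \<open>The bottom values make sense only at positive depth; at time 0 no object has
    been seen, contradicting \<open>k > 0\<close>.\<close>
  have "s \<noteq> 0"
  proof
    assume "s = 0"
    then have "seen h = {}" by (simp add: h_def seen_def)
    with out(2) k show False by simp
  qed
  then have pos: "0 < s div m" using out(1) m by (auto elim: dvdE)
  have "is_T m k t h Y" using sel out(2,3) by (simp add: T_selection_def)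
  then have "top_k m k t D Y" using top_k_if_halted[OF D rd mono m k pos] out(4) by blast
  with Y show ?thesis by blast
qed

text \<open>Taking the maximum with \<open>k\<close> guarantees that \<open>T\<close> can be formed.
  The case split reflects that an extremal database needs
  \<open>d \<le> card (objs D)\<close>.\<close>

lemma NRA_vs_correct:
  assumes A: "A \<in> correct_algorithms m k t" and out: "outputs_after A D s Y"
  shows "\<exists>s'\<le>(s + k) * m. \<exists>Y'. outputs_after (NRA m k t sel) D s' Y'"
proof -
  let ?d = "max s k"
  have le: "?d * m \<le> (s + k) * m" by simp
  have "\<exists>s'\<le>?d * m. \<exists>Y'. outputs_after (NRA m k t sel) D s' Y'"
  proof (cases "card (objs D) \<le> ?d")
    case True
    then have "card (objs D) * m \<le> ?d * m" by (rule mult_le_mono1)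
    then show ?thesis using NRA_halts le_trans by blast
  next
    case False
    obtain s' Y' where "outputs_after A D s' Y'" "top_k m k t D Y'"
      using A D by (auto simp: correct_algorithms_def)
    then have "top_k m k t D Y" using outputs_after_unique[OF out] by metis
    then have Y: "Y \<subseteq> objs D" "card Y = k" by (auto simp: top_k_def)
    have pos: "0 < ?d" using k by simp
    show ?thesis
    proof (rule NRA_halts_by)
      show "B m t h R \<le> M m t h T"
        if rd: "read_to_depth m D ?d h" and T: "is_T m k t h T" and R: "R \<in> objs D - T" for h T R
      proof (rule halted_if_separated[OF D rd mono m k pos T Y _ R])
        show "B m t h R \<le> W m t h R'" if "R \<in> objs D - Y" "R' \<in> Y" for R R'
          using correct_output_separated[OF D rd mono m k pos A out _ _ that Y(1)] \<open>\<not> _ \<le> ?d\<close>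
          by (meson max.cobounded1 nle_le)
      qed
    qed simp
  qed
  with le show ?thesis using le_trans by blast
qed

end

theorem theorem8p5:
  fixes m k :: nat and c\<^sub>S :: real and t :: "real list \<Rightarrow> real"
    and sel :: "'o set \<Rightarrow> 'o history \<Rightarrow> 'o set"
  assumes "m > 0" and "k > 0" and "c\<^sub>S > 0"
    and "aggregation m t" and "monotone_aggregation m t"
    and "T_selection m k t sel"
  shows "instance_optimal (cost c\<^sub>S) (NRA m k t sel)
           (correct_algorithms m k t) (databases m k)"
proof -
  let ?N = "NRA m k t sel"
  \<comment> \<open>Each unit of depth costs \<open>m\<close> accesses, whence the factor
    \<open>m\<close>; the summand \<open>k\<close> in the depth bound gives the additive constant.
    Neither depends on \<open>A\<close> or \<open>D\<close>.\<close>
  have "cost c\<^sub>S ?N D \<le> real m * cost c\<^sub>S A D + real (k * m) * c\<^sub>S"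
    if A: "A \<in> correct_algorithms m k t" and D: "D \<in> databases m k" for A and D :: "'o database"
  proof -
    define s where "s = (LEAST s. \<exists>Y. outputs_after A D s Y)"
    have "\<exists>s Y. outputs_after A D s Y"
      using A D unfolding correct_algorithms_def by blast
    then obtain Y where "outputs_after A D s Y"
      using LeastI_ex[of "\<lambda>s. \<exists>Y. outputs_after A D s Y"] unfolding s_def by auto
    then obtain s' where s': "s' \<le> (s + k) * m" "\<exists>Y'. outputs_after ?N D s' Y'"
      using NRA_vs_correct[OF assms(1,2,5,6) D A] by blast
    have "(LEAST s. \<exists>Y. outputs_after ?N D s Y) \<le> (s + k) * m"
      using Least_le[of "\<lambda>s. \<exists>Y. outputs_after ?N D s Y", OF s'(2)] s'(1) by linarith
    then have "cost c\<^sub>S ?N D \<le> real ((s + k) * m) * c\<^sub>S"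
      unfolding cost_def using \<open>c\<^sub>S > 0\<close> by (intro mult_right_mono of_nat_mono) auto
    also have "\<dots> = real m * cost c\<^sub>S A D + real (k * m) * c\<^sub>S"
      by (simp add: cost_def s_def[symmetric] algebra_simps)
    finally show ?thesis .
  qed
  moreover have "?N \<in> correct_algorithms m k t"
    using NRA_top_k[OF assms(1,2,5,6)] by (auto simp: correct_algorithms_def)
  ultimately show ?thesis unfolding instance_optimal_def by blast
qed

end
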